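(* Let $u^0\in\mathbb{M}_h$ satisfy $\|u^0\|_\infty\le\beta$, and suppose $$0<\tau\le\min\Big\{\frac{h^2}{\kappa h^2+2\varepsilon^2},\ \frac{1}{\kappa+\|f'\|_{C[-\beta,\beta]}}\Big\}.$$ Then the ESS1-adjoint method is uniquely solvable in $[-\beta,\beta]$: at each step $0\le n\le N_t-1$, given $u^n$, there is exactly one $u^{n+1}\in\mathbb{M}_h$ with all entries in $[-\beta,\beta]$ satisfying the ESS1-adjoint equation. Consequently, the solutions generated by the ESS1-adjoint method satisfy $$\|u^n\|_\infty\le\beta,\qquad 0\le n\le N_t.$$
   Context: Problem: the two-dimensional Allen-Cahn equation $u_t=\varepsilon^2\Delta u+f(u)$ on $\Omega=(0,2\pi)^2$ with periodic boundary conditions, $t\in(0,T]$, $T>0$, $\varepsilon>0$. Assumptions on $f$: $\beta>0$ is a constant, $f$ is a real-valued function on an interval containing $[-\beta,\beta]$, continuously differentiable on $[-\beta,\beta]$; $f$ is odd and $f(\beta)=0$. Write $\|f'\|_{C[-\beta,\beta]}=\max_{\xi\in[-\beta,\beta]}|f'(\xi)|$. Grid: $M$ is a positive integer, $h=2\pi/M$. $\mathbb{M}_h$ is the space of real grid functions $v=(v_{ij})_{0\le i,j\le M-1}$, identified with $M\times M$ real matrices, and $\|v\|_\infty=\max_{i,j}|v_{ij}|$. $\tau>0$ is the time step, $t_n=n\tau$, $N_t=\lfloor T/\tau\rfloor$. Operators: $D_a$ is the $M\times M$ matrix (indices $0,\dots,M-1$) equal to $h^{-2}$ times the matrix with $-1$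 on the diagonal, $1$ at positions $(i,i+1)$ for $0\le i\le M-2$, $1$ at position $(0,M-1)$, and zeros elsewhere (contributions at coinciding positions are added when $M\le 2$). $D_b=D_a^{\mathrm T}$. For $v\in\mathbb{M}_h$ set $\varDelta_a v=D_av+vD_a^{\mathrm T}$ and $\varDelta_b v=D_bv+vD_b^{\mathrm T}$. ESS1-adjoint method with stabilization parameter $\kappa\ge 0$: $f$ acts entrywise, and $u^{n+1}$ is a solution, given $u^n$, of $$\frac{u^{n+1}-u^n}{\tau}=\varepsilon^2(\varDelta_au^{n+1}+\varDelta_bu^{n})+f(u^{n+1})+\kappa(u^{n+1}-u^n);$$ the solution generated by the method is the one whose entries lie in $[-\beta,\beta]$. The quantity $1/(\kappa+\|f'\|_{C[-\beta,\beta]})$ is read as $+\infty$ if its denominator vanishes.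
   Formalization: For the one-point grid M = 1 the bound τ ≤ 1/(κ+‖f'‖) is required to be strict; with equality uniqueness can fail (κ = 0, τ = 1, f(v) = v near 0, ‖f'‖ = 1, u⁰ = 0). Nothing changes for M ≥ 2. *)

theory Defs
  imports "HOL-Analysis.Analysis" "Jordan_Normal_Form.Matrix"
begin

text \<open>Grid functions on the periodic \<open>M \<times> M\<close> grid are elements of \<^term>\<open>carrier_mat M M\<close>.\<close>

definition mesh :: "nat \<Rightarrow> real" where
  "mesh M = 2 * pi / real M"

definition grid_norm :: "real mat \<Rightarrow> real" where
  "grid_norm v = Max {\<bar>v $$ (i, j)\<bar> | i j. i < dim_row v \<and> j < dim_col v}"

text \<open>Applied only to continuous functions, for which the supremum is a maximum.\<close>

definition sup_norm_on :: "real set \<Rightarrow> (real \<Rightarrow> real) \<Rightarrow> real" where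
  "sup_norm_on S g = (SUP x\<in>S. \<bar>g x\<bar>)"

text \<open>
  \<open>D_a\<close> is upper triangular, not circulant: the periodic corner entry sits at \<open>(0, M - 1)\<close>, so
  that \<open>D_a + D_a\<^sup>T\<close> is the periodic second-difference matrix. The three contributions are
  summed, which matters where they coincide: at \<open>(0, 1)\<close> for \<open>M = 2\<close>, and at \<open>(0, 0)\<close> for
  \<open>M = 1\<close>, where \<open>D_a = 0\<close>.
\<close>

definition D_a :: "nat \<Rightarrow> real mat" where
  "D_a M = (1 / (mesh M)\<^sup>2) \<cdot>\<^sub>m mat M M (\<lambda>(i, j).
     (if i = j then -1 else 0) + (if j = i + 1 then 1 else 0)
       + (if i = 0 \<and> j = M - 1 then 1 else 0))"

definition D_b :: "nat \<Rightarrow> real mat" where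
  "D_b M = transpose_mat (D_a M)"

definition Delta_a :: "nat \<Rightarrow> real mat \<Rightarrow> real mat" where
  "Delta_a M v = D_a M * v + v * transpose_mat (D_a M)"

definition Delta_b :: "nat \<Rightarrow> real mat \<Rightarrow> real mat" where
  "Delta_b M v = D_b M * v + v * transpose_mat (D_b M)"

definition ess1_adjoint_eq ::
  "nat \<Rightarrow> real \<Rightarrow> real \<Rightarrow> real \<Rightarrow> (real \<Rightarrow> real) \<Rightarrow> real mat \<Rightarrow> real mat \<Rightarrow> bool" where
  "ess1_adjoint_eq M \<epsilon> \<kappa> \<tau> f u v \<longleftrightarrow>
     (1 / \<tau>) \<cdot>\<^sub>m (v - u) =
       \<epsilon>\<^sup>2 \<cdot>\<^sub>m (Delta_a M v + Delta_b M u) + map_mat f v + \<kappa> \<cdot>\<^sub>m (v - u)"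

definition ess1_adjoint_sol ::
  "nat \<Rightarrow> real \<Rightarrow> real \<Rightarrow> real \<Rightarrow> real \<Rightarrow> (real \<Rightarrow> real) \<Rightarrow> real mat \<Rightarrow> real mat \<Rightarrow> bool" where
  "ess1_adjoint_sol M \<beta> \<epsilon> \<kappa> \<tau> f u v \<longleftrightarrow>
     v \<in> carrier_mat M M \<and> (\<forall>i<M. \<forall>j<M. v $$ (i, j) \<in> {-\<beta>..\<beta>}) \<and>
     ess1_adjoint_eq M \<epsilon> \<kappa> \<tau> f u v"

text \<open>
  The method selects the solution with entries in \<open>[-\<beta>, \<beta>]\<close>; the description below says
  nothing about its value unless there is exactly one such solution.
\<close>

primrec ess1_adjoint ::
  "nat \<Rightarrow> real \<Rightarrow> real \<Rightarrow> real \<Rightarrow> real \<Rightarrow> (real \<Rightarrow> real) \<Rightarrow> real mat \<Rightarrow> nat \<Rightarrow> real mat" where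
  "ess1_adjoint M \<beta> \<epsilon> \<kappa> \<tau> f u0 0 = u0"
| "ess1_adjoint M \<beta> \<epsilon> \<kappa> \<tau> f u0 (Suc n) =
     (THE v. ess1_adjoint_sol M \<beta> \<epsilon> \<kappa> \<tau> f (ess1_adjoint M \<beta> \<epsilon> \<kappa> \<tau> f u0 n) v)"

text \<open>
  The extended reals give \<open>1 / 0 = \<infinity>\<close>, as wanted when \<open>\<kappa>\<close> and \<open>f'\<close> vanish.
  On the one-point grid \<open>M = 1\<close>, where \<open>D_a = 0\<close>, uniqueness needs \<open>\<tau>\<close> strictly below this
  bound: at equality, with \<open>\<kappa> = 0\<close> and \<open>f v = v\<close> near \<open>0\<close>, so that \<open>\<tau> = 1\<close> is possible, the
  step from \<open>u = 0\<close> reads \<open>v = f v\<close>, which every small \<open>v\<close> solves.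
\<close>

definition stab_bound :: "real \<Rightarrow> real \<Rightarrow> (real \<Rightarrow> real) \<Rightarrow> ereal" where
  "stab_bound \<beta> \<kappa> f' = 1 / ereal (\<kappa> + sup_norm_on {-\<beta>..\<beta>} f')"

end

theory Submission
  imports Defs
begin

text \<open>
  Although \<open>\<Delta>\<^sub>a\<close> is applied to the unknown, each step is explicit up to scalar
  equations. The matrix \<open>D\<^sub>a\<close> is upper triangular with a constant diagonal \<open>-\<delta>\<close>, so the
  equation at \<open>(i, j)\<close> couples \<open>v\<^sub>i\<^sub>j\<close> only to unknowns with a larger index in one of the two
  directions. It reads \<open>g v\<^sub>i\<^sub>j = r\<^sub>i\<^sub>j\<close> with
  \<open>g x = (1 / \<tau> - \<kappa> + 2 \<epsilon>\<^sup>2 \<delta>) x - f x\<close>, where \<open>r\<^sub>i\<^sub>j\<close> collects the old values and those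
  later unknowns. Backward substitution, starting at \<open>(M - 1, M - 1)\<close>, therefore solves the
  system, provided that \<open>g x = r\<^sub>i\<^sub>j\<close> always has exactly one solution in \<open>[-\<beta>, \<beta>]\<close>.

  Uniqueness holds because \<open>g\<close> is strictly increasing: the second bound on \<open>\<tau>\<close> says
  \<open>1 / \<tau> - \<kappa> \<ge> \<parallel>f'\<parallel>\<close>, and the inequality becomes strict through \<open>\<delta> > 0\<close> if \<open>M \<ge> 2\<close>
  and through the strict bound on \<open>\<tau>\<close> if \<open>M = 1\<close>, where \<open>\<delta> = 0\<close>.

  Existence is a discrete maximum principle. Since \<open>f (\<plusminus>\<beta>) = 0\<close>, the function \<open>g\<close> maps
  \<open>[-\<beta>, \<beta>]\<close> onto \<open>[-R, R]\<close> with \<open>R = (1 / \<tau> - \<kappa> + 2 \<epsilon>\<^sup>2 \<delta>) \<beta>\<close>. The first bound on \<open>\<tau>\<close>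
  makes the coefficient \<open>1 / \<tau> - \<kappa> - 2 \<epsilon>\<^sup>2 \<delta>\<close> of \<open>u\<^sub>i\<^sub>j\<close> in \<open>r\<^sub>i\<^sub>j\<close> nonnegative, and the
  neighbour coefficients add up to \<open>4 \<epsilon>\<^sup>2 \<delta>\<close> because the rows of \<open>D\<^sub>a + D\<^sub>a\<^sup>T\<close> sum to zero.
  As all values are bounded by \<open>\<beta>\<close>, this gives \<open>\<bar>r\<^sub>i\<^sub>j\<bar> \<le> R\<close>: exactly what is needed.
\<close>

section \<open>Nonlinear triangular systems\<close>

text \<open>
  Backward substitution. The right-hand side at \<open>p\<close> depends only on unknowns of smaller rank,
  so a solution can be defined by well-founded recursion, each value being chosen as a
  solution of its scalar equation. Solvability of that equation is only required once the
  earlier values are known to lie in \<open>I\<close>, which the induction supplies.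
\<close>

lemma triangular_system_solvable:
  fixes rank :: "'a \<Rightarrow> nat" and g :: "'b \<Rightarrow> 'c" and F :: "'a \<Rightarrow> ('a \<Rightarrow> 'b) \<Rightarrow> 'c"
  assumes dep: "\<And>p v w. p \<in> S \<Longrightarrow> (\<And>q. q \<in> S \<Longrightarrow> rank q < rank p \<Longrightarrow> v q = w q)
      \<Longrightarrow> F p v = F p w"
    and solvable: "\<And>p v. p \<in> S \<Longrightarrow> (\<And>q. q \<in> S \<Longrightarrow> rank q < rank p \<Longrightarrow> v q \<in> I)
      \<Longrightarrow> \<exists>x\<in>I. g x = F p v"
  shows "\<exists>v. \<forall>p\<in>S. v p \<in> I \<and> g (v p) = F p v"
proof -
  let ?R = "inv_image less_than rank"
  define H where "H = (\<lambda>v p. SOME x. x \<in> I \<and> g x = F p v)"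
  define v where "v = wfrec ?R H"
  have v_rec: "v p = (SOME x. x \<in> I \<and> g x = F p v)" if "p \<in> S" for p
  proof -
    have "v p = H (cut v ?R p) p"
      unfolding v_def by (rule wfrec[OF wf_inv_image[OF wf_less_than]])
    moreover have "F p (cut v ?R p) = F p v"
      by (rule dep[OF that]) (simp add: cut_def)
    ultimately show ?thesis by (simp add: H_def)
  qed
  have "p \<in> S \<longrightarrow> v p \<in> I \<and> g (v p) = F p v" for p
  proof (induction "rank p" arbitrary: p rule: less_induct)
    case less
    show ?case
    proof
      assume p: "p \<in> S"
      have "\<exists>x. x \<in> I \<and> g x = F p v"
        using solvable[OF p, of v] less by blast
      from someI_ex[OF this] show "v p \<in> I \<and> g (v p) = F p v"
        by (simp only: v_rec[OF p, symmetric])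
    qed
  qed
  then show ?thesis by blast
qed

lemma triangular_system_unique:
  fixes rank :: "'a \<Rightarrow> nat" and g :: "'b \<Rightarrow> 'c" and F :: "'a \<Rightarrow> ('a \<Rightarrow> 'b) \<Rightarrow> 'c"
  assumes dep: "\<And>p v w. p \<in> S \<Longrightarrow> (\<And>q. q \<in> S \<Longrightarrow> rank q < rank p \<Longrightarrow> v q = w q)
      \<Longrightarrow> F p v = F p w"
    and inj: "inj_on g I"
    and v: "\<And>p. p \<in> S \<Longrightarrow> v p \<in> I \<and> g (v p) = F p v"
    and w: "\<And>p. p \<in> S \<Longrightarrow> w p \<in> I \<and> g (w p) = F p w"
    and "p \<in> S"
  shows "v p = w p"
  using \<open>p \<in> S\<close>
proof (induction "rank p" arbitrary: p rule: less_induct)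
  case less
  have "F p v = F p w" using dep[OF less.prems, of v w] less.hyps by blast
  then have "g (v p) = g (w p)" using v[OF less.prems] w[OF less.prems] by simp
  then show ?case using inj_onD[OF inj] v[OF less.prems] w[OF less.prems] by blast
qed

section \<open>The matrix of one-sided differences\<close>

definition diag_weight :: "nat \<Rightarrow> real" where
  "diag_weight M = (if M = 1 then 0 else 1 / (mesh M)\<^sup>2)"

lemma mesh_pos: "M > 0 \<Longrightarrow> mesh M > 0"
  by (simp add: mesh_def)

lemma diag_weight_le: "diag_weight M \<le> 1 / (mesh M)\<^sup>2"
  by (simp add: diag_weight_def)

lemma D_a_carrier [simp]: "D_a M \<in> carrier_mat M M"
  by (simp add: D_a_def)

lemma D_a_dims [simp]: "dim_row (D_a M) = M" "dim_col (D_a M) = M"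
  by (simp_all add: D_a_def)

lemma D_a_entry:
  assumes "i < M" "k < M"
  shows "D_a M $$ (i, k) = (1 / (mesh M)\<^sup>2) *
    ((if i = k then -1 else 0) + (if k = i + 1 then 1 else 0)
       + (if i = 0 \<and> k = M - 1 then 1 else 0))"
  using assms by (simp add: D_a_def)

lemma D_a_diag: "i < M \<Longrightarrow> D_a M $$ (i, i) = - diag_weight M"
  by (auto simp: D_a_entry diag_weight_def)

lemma D_a_lower: "k < i \<Longrightarrow> i < M \<Longrightarrow> D_a M $$ (i, k) = 0"
  by (auto simp: D_a_entry)

lemma D_a_upper_nonneg: "i < k \<Longrightarrow> k < M \<Longrightarrow> D_a M $$ (i, k) \<ge> 0"
  by (auto simp: D_a_entry)

lemma sum_split_at:
  fixes g :: "nat \<Rightarrow> real"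
  assumes "i < M"
  shows "(\<Sum>k<M. g k) = (\<Sum>k<i. g k) + g i + (\<Sum>k\<in>{i<..<M}. g k)"
proof -
  have "{..<M} = insert i ({..<i} \<union> {i<..<M})" using assms by auto
  moreover have "sum g ({..<i} \<union> {i<..<M}) = sum g {..<i} + sum g {i<..<M}"
    by (rule sum.union_disjoint) auto
  ultimately show ?thesis by simp
qed

lemma D_a_row_apply:
  assumes "i < M"
  shows "(\<Sum>k<M. D_a M $$ (i, k) * x k) =
    - diag_weight M * x i + (\<Sum>k\<in>{i<..<M}. D_a M $$ (i, k) * x k)"
  using assms by (simp add: sum_split_at D_a_diag D_a_lower)

lemma D_a_col_apply:
  assumes "i < M"
  shows "(\<Sum>k<M. D_a M $$ (k, i) * x k) =
    - diag_weight M * x i + (\<Sum>k<i. D_a M $$ (k, i) * x k)"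
  using assms by (simp add: sum_split_at D_a_diag D_a_lower)

text \<open>
  The rows of \<open>D\<^sub>a + D\<^sub>a\<^sup>T\<close> sum to zero, since this is the periodic second-difference matrix.
  For \<open>M \<ge> 2\<close> the rows of \<open>D\<^sub>a\<close> alone do not: the first has an excess and the last a
  deficit, which cancel against those of the transpose.
\<close>

lemma D_a_off_diag_sum:
  assumes i: "i < M"
  shows "(\<Sum>k\<in>{i<..<M}. D_a M $$ (i, k)) + (\<Sum>k<i. D_a M $$ (k, i)) = 2 * diag_weight M"
proof -
  have row: "(\<Sum>k<M. D_a M $$ (i, k)) = (1 / (mesh M)\<^sup>2) *
      (-1 + (if i + 1 < M then 1 else 0) + (if i = 0 then 1 else 0))"
  proof -
    have "(\<Sum>k<M. D_a M $$ (i, k)) = (1 / (mesh M)\<^sup>2) *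
        ((\<Sum>k<M. if k = i then -1 else 0) + (\<Sum>k<M. if k = i + 1 then 1 else 0)
          + (\<Sum>k<M. if k = M - 1 then (if i = 0 then 1 else 0) else 0))"
      unfolding sum.distrib[symmetric] sum_distrib_left
      by (rule sum.cong) (use i in \<open>auto simp: D_a_entry\<close>)
    then show ?thesis using i by simp
  qed
  have col: "(\<Sum>k<M. D_a M $$ (k, i)) = (1 / (mesh M)\<^sup>2) *
      (-1 + (if i \<ge> 1 then 1 else 0) + (if i = M - 1 then 1 else 0))"
  proof -
    have "(\<Sum>k<M. D_a M $$ (k, i)) = (1 / (mesh M)\<^sup>2) *
        ((\<Sum>k<M. if k = i then -1 else 0)
          + (\<Sum>k<M. if k = i - 1 then (if i \<ge> 1 then 1 else 0) else 0)
          + (\<Sum>k<M. if k = 0 then (if i = M - 1 then 1 else 0) else 0))"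
      unfolding sum.distrib[symmetric] sum_distrib_left
      by (rule sum.cong) (use i in \<open>auto simp: D_a_entry\<close>)
    then show ?thesis using i by auto
  qed
  have "(\<Sum>k<M. D_a M $$ (i, k)) + (\<Sum>k<M. D_a M $$ (k, i)) = 0"
    unfolding row col using i by (auto simp: field_simps)
  then show ?thesis
    using D_a_row_apply[OF i, of "\<lambda>_. 1"] D_a_col_apply[OF i, of "\<lambda>_. 1"] by simp
qed

section \<open>The scheme in components\<close>

definition upper_nbrs :: "nat \<Rightarrow> nat \<times> nat \<Rightarrow> (nat \<times> nat \<Rightarrow> real) \<Rightarrow> real" where
  "upper_nbrs M p v = (case p of (i, j) \<Rightarrow>
     (\<Sum>k\<in>{i<..<M}. D_a M $$ (i, k) * v (k, j)) + (\<Sum>k\<in>{j<..<M}. D_a M $$ (j, k) * v (i, k)))"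

definition lower_nbrs :: "nat \<Rightarrow> nat \<times> nat \<Rightarrow> (nat \<times> nat \<Rightarrow> real) \<Rightarrow> real" where
  "lower_nbrs M p v = (case p of (i, j) \<Rightarrow>
     (\<Sum>k<i. D_a M $$ (k, i) * v (k, j)) + (\<Sum>k<j. D_a M $$ (k, j) * v (i, k)))"

lemma index_mult_mat_sum:
  assumes "A \<in> carrier_mat M M" "B \<in> carrier_mat M M" "i < M" "j < M"
  shows "(A * B) $$ (i, j) = (\<Sum>k<M. A $$ (i, k) * B $$ (k, j) :: real)"
  using assms by (auto simp: scalar_prod_def atLeast0LessThan intro!: sum.cong)

lemma Delta_a_carrier: "v \<in> carrier_mat M M \<Longrightarrow> Delta_a M v \<in> carrier_mat M M"
  unfolding Delta_a_def by (intro add_carrier_mat mult_carrier_mat) auto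

lemma Delta_b_carrier: "v \<in> carrier_mat M M \<Longrightarrow> Delta_b M v \<in> carrier_mat M M"
  unfolding Delta_b_def D_b_def by (intro add_carrier_mat mult_carrier_mat) auto

lemma Delta_a_entry:
  assumes v: "v \<in> carrier_mat M M" and ij: "i < M" "j < M"
  shows "Delta_a M v $$ (i, j) =
    - 2 * diag_weight M * v $$ (i, j) + upper_nbrs M (i, j) (($$) v)"
proof -
  have T: "transpose_mat (D_a M) \<in> carrier_mat M M" by simp
  have tr: "transpose_mat (D_a M) $$ (k, j) = D_a M $$ (j, k)" if "k < M" for k
    using that ij by simp
  have "Delta_a M v $$ (i, j) = (D_a M * v) $$ (i, j) + (v * transpose_mat (D_a M)) $$ (i, j)"
    unfolding Delta_a_def using v ij mult_carrier_mat[OF v T] by (intro index_add_mat) auto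
  also have "\<dots> = (\<Sum>k<M. D_a M $$ (i, k) * v $$ (k, j)) + (\<Sum>k<M. D_a M $$ (j, k) * v $$ (i, k))"
    using ij by (simp add: index_mult_mat_sum[OF D_a_carrier v] index_mult_mat_sum[OF v T] tr mult.commute
      del: index_mult_mat)
  finally show ?thesis
    using ij D_a_row_apply[of i M "\<lambda>k. v $$ (k, j)"] D_a_row_apply[of j M "\<lambda>k. v $$ (i, k)"]
    by (simp add: upper_nbrs_def)
qed

lemma Delta_b_entry:
  assumes v: "v \<in> carrier_mat M M" and ij: "i < M" "j < M"
  shows "Delta_b M v $$ (i, j) =
    - 2 * diag_weight M * v $$ (i, j) + lower_nbrs M (i, j) (($$) v)"
proof -
  have T: "transpose_mat (D_a M) \<in> carrier_mat M M" by simp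
  have tr: "transpose_mat (D_a M) $$ (i, k) = D_a M $$ (k, i)" if "k < M" for k
    using that ij by simp
  have "Delta_b M v $$ (i, j) = (transpose_mat (D_a M) * v) $$ (i, j) + (v * D_a M) $$ (i, j)"
    unfolding Delta_b_def D_b_def transpose_transpose
    using v ij mult_carrier_mat[OF v D_a_carrier] by (intro index_add_mat) auto
  also have "\<dots> = (\<Sum>k<M. D_a M $$ (k, i) * v $$ (k, j)) + (\<Sum>k<M. D_a M $$ (k, j) * v $$ (i, k))"
    using ij by (simp add: index_mult_mat_sum[OF v D_a_carrier] index_mult_mat_sum[OF T v] tr mult.commute
      del: index_mult_mat)
  finally show ?thesis
    using ij D_a_col_apply[of i M "\<lambda>k. v $$ (k, j)"] D_a_col_apply[of j M "\<lambda>k. v $$ (i, k)"]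
    by (simp add: lower_nbrs_def)
qed

text \<open>
  The equation at a grid point \<open>p\<close>, with every occurrence of the unknown \<open>v p\<close> moved to the
  left, is \<open>local_fun (v p) = local_rhs p v\<close>.
\<close>

definition local_fun :: "nat \<Rightarrow> real \<Rightarrow> real \<Rightarrow> real \<Rightarrow> (real \<Rightarrow> real) \<Rightarrow> real \<Rightarrow> real" where
  "local_fun M \<epsilon> \<kappa> \<tau> f x = (1 / \<tau> - \<kappa> + 2 * \<epsilon>\<^sup>2 * diag_weight M) * x - f x"

definition local_rhs :: "nat \<Rightarrow> real \<Rightarrow> real \<Rightarrow> real \<Rightarrow> (nat \<times> nat \<Rightarrow> real)
    \<Rightarrow> nat \<times> nat \<Rightarrow> (nat \<times> nat \<Rightarrow> real) \<Rightarrow> real" where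
  "local_rhs M \<epsilon> \<kappa> \<tau> u p v = (1 / \<tau> - \<kappa> - 2 * \<epsilon>\<^sup>2 * diag_weight M) * u p
     + \<epsilon>\<^sup>2 * (upper_nbrs M p v + lower_nbrs M p u)"

lemma ess1_adjoint_eq_iff_local:
  assumes u: "u \<in> carrier_mat M M" and v: "v \<in> carrier_mat M M"
  shows "ess1_adjoint_eq M \<epsilon> \<kappa> \<tau> f u v \<longleftrightarrow>
    (\<forall>i<M. \<forall>j<M. local_fun M \<epsilon> \<kappa> \<tau> f (v $$ (i, j)) = local_rhs M \<epsilon> \<kappa> \<tau> (($$) u) (i, j) (($$) v))"
proof -
  let ?L = "(1 / \<tau>) \<cdot>\<^sub>m (v - u)"
  let ?R = "\<epsilon>\<^sup>2 \<cdot>\<^sub>m (Delta_a M v + Delta_b M u) + map_mat f v + \<kappa> \<cdot>\<^sub>m (v - u)"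
  have dims: "dim_row u = M" "dim_col u = M" "dim_row v = M" "dim_col v = M"
      "dim_row (Delta_a M v) = M" "dim_col (Delta_a M v) = M"
      "dim_row (Delta_b M u) = M" "dim_col (Delta_b M u) = M"
    using u v Delta_a_carrier[OF v] Delta_b_carrier[OF u] by auto
  have "?L = ?R \<longleftrightarrow> (\<forall>i<M. \<forall>j<M. ?L $$ (i, j) = ?R $$ (i, j))"
  proof
    assume "\<forall>i<M. \<forall>j<M. ?L $$ (i, j) = ?R $$ (i, j)"
    then show "?L = ?R" by (intro eq_matI) (simp_all add: dims)
  qed simp
  also have "\<dots> \<longleftrightarrow> (\<forall>i<M. \<forall>j<M. local_fun M \<epsilon> \<kappa> \<tau> f (v $$ (i, j)) =
      local_rhs M \<epsilon> \<kappa> \<tau> (($$) u) (i, j) (($$) v))"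
  proof -
    have "?L $$ (i, j) = ?R $$ (i, j) \<longleftrightarrow>
        local_fun M \<epsilon> \<kappa> \<tau> f (v $$ (i, j)) = local_rhs M \<epsilon> \<kappa> \<tau> (($$) u) (i, j) (($$) v)"
      if "i < M" "j < M" for i j
    proof -
      have "?L $$ (i, j) = (1 / \<tau>) * (v $$ (i, j) - u $$ (i, j))"
        using that by (simp add: dims)
      moreover have "?R $$ (i, j) = \<epsilon>\<^sup>2 * (- 2 * diag_weight M * v $$ (i, j)
          + upper_nbrs M (i, j) (($$) v) - 2 * diag_weight M * u $$ (i, j)
          + lower_nbrs M (i, j) (($$) u)) + f (v $$ (i, j)) + \<kappa> * (v $$ (i, j) - u $$ (i, j))"
        using that by (simp add: dims Delta_a_entry[OF v] Delta_b_entry[OF u])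
      ultimately show ?thesis
        unfolding local_fun_def local_rhs_def by (simp only:) (auto simp: algebra_simps)
    qed
    then show ?thesis by blast
  qed
  finally show ?thesis unfolding ess1_adjoint_eq_def .
qed

section \<open>The discrete maximum principle for one step\<close>

lemma abs_weighted_sum_le:
  fixes a x :: "nat \<Rightarrow> real"
  assumes "\<And>k. k \<in> K \<Longrightarrow> a k \<ge> 0" and "\<And>k. k \<in> K \<Longrightarrow> \<bar>x k\<bar> \<le> \<beta>"
  shows "\<bar>\<Sum>k\<in>K. a k * x k\<bar> \<le> (\<Sum>k\<in>K. a k) * \<beta>"
proof -
  have "\<bar>\<Sum>k\<in>K. a k * x k\<bar> \<le> (\<Sum>k\<in>K. \<bar>a k * x k\<bar>)" by (rule sum_abs)
  also have "\<dots> \<le> (\<Sum>k\<in>K. a k * \<beta>)"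
    using assms by (intro sum_mono) (simp add: abs_mult mult_left_mono)
  finally show ?thesis by (simp add: sum_distrib_right)
qed

text \<open>
  During backward substitution only the values \<open>v (k, l)\<close> with \<open>i + j < k + l\<close> are known to
  be bounded, so no more is assumed of \<open>v\<close> here. The upper and lower neighbours have to be
  estimated together: separately, the weights of either kind depend on the position.
\<close>

lemma abs_nbrs_le:
  assumes ij: "i < M" "j < M"
    and v: "\<And>k l. k < M \<Longrightarrow> l < M \<Longrightarrow> i + j < k + l \<Longrightarrow> \<bar>v (k, l)\<bar> \<le> \<beta>"
    and u: "\<And>k l. k < M \<Longrightarrow> l < M \<Longrightarrow> \<bar>u (k, l)\<bar> \<le> \<beta>"
  shows "\<bar>upper_nbrs M (i, j) v + lower_nbrs M (i, j) u\<bar> \<le> 4 * diag_weight M * \<beta>"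
proof -
  have "\<bar>\<Sum>k\<in>{i<..<M}. D_a M $$ (i, k) * v (k, j)\<bar> \<le> (\<Sum>k\<in>{i<..<M}. D_a M $$ (i, k)) * \<beta>"
    "\<bar>\<Sum>k\<in>{j<..<M}. D_a M $$ (j, k) * v (i, k)\<bar> \<le> (\<Sum>k\<in>{j<..<M}. D_a M $$ (j, k)) * \<beta>"
    "\<bar>\<Sum>k<i. D_a M $$ (k, i) * u (k, j)\<bar> \<le> (\<Sum>k<i. D_a M $$ (k, i)) * \<beta>"
    "\<bar>\<Sum>k<j. D_a M $$ (k, j) * u (i, k)\<bar> \<le> (\<Sum>k<j. D_a M $$ (k, j)) * \<beta>"
    using ij by (auto intro!: abs_weighted_sum_le v u D_a_upper_nonneg)
  then have "\<bar>upper_nbrs M (i, j) v + lower_nbrs M (i, j) u\<bar> \<le>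
      ((\<Sum>k\<in>{i<..<M}. D_a M $$ (i, k)) + (\<Sum>k<i. D_a M $$ (k, i))) * \<beta>
      + ((\<Sum>k\<in>{j<..<M}. D_a M $$ (j, k)) + (\<Sum>k<j. D_a M $$ (k, j))) * \<beta>"
    unfolding upper_nbrs_def lower_nbrs_def by (simp add: distrib_right)
  then show ?thesis using ij by (simp only: D_a_off_diag_sum)
qed

text \<open>
  The sign of the coefficient of \<open>u p\<close> is what makes the estimate sharp enough: the weights
  \<open>1 / \<tau> - \<kappa> - 2 \<epsilon>\<^sup>2 \<delta>\<close> and \<open>4 \<epsilon>\<^sup>2 \<delta>\<close> then add up without absolute values to the slope
  of the linear part of \<open>local_fun\<close>.
\<close>

lemma abs_local_rhs_le:
  assumes ij: "i < M" "j < M"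
    and coeff: "1 / \<tau> - \<kappa> - 2 * \<epsilon>\<^sup>2 * diag_weight M \<ge> 0"
    and v: "\<And>k l. k < M \<Longrightarrow> l < M \<Longrightarrow> i + j < k + l \<Longrightarrow> \<bar>v (k, l)\<bar> \<le> \<beta>"
    and u: "\<And>k l. k < M \<Longrightarrow> l < M \<Longrightarrow> \<bar>u (k, l)\<bar> \<le> \<beta>"
  shows "\<bar>local_rhs M \<epsilon> \<kappa> \<tau> u (i, j) v\<bar> \<le> (1 / \<tau> - \<kappa> + 2 * \<epsilon>\<^sup>2 * diag_weight M) * \<beta>"
proof -
  let ?c = "1 / \<tau> - \<kappa> - 2 * \<epsilon>\<^sup>2 * diag_weight M"
  have "\<bar>local_rhs M \<epsilon> \<kappa> \<tau> u (i, j) v\<bar> \<le>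
      \<bar>?c * u (i, j)\<bar> + \<bar>\<epsilon>\<^sup>2 * (upper_nbrs M (i, j) v + lower_nbrs M (i, j) u)\<bar>"
    unfolding local_rhs_def by (rule abs_triangle_ineq)
  also have "\<dots> \<le> ?c * \<beta> + \<epsilon>\<^sup>2 * (4 * diag_weight M * \<beta>)"
  proof (rule add_mono)
    show "\<bar>?c * u (i, j)\<bar> \<le> ?c * \<beta>"
      using mult_left_mono[OF u[OF ij] coeff] coeff by (simp add: abs_mult)
    have "\<bar>upper_nbrs M (i, j) v + lower_nbrs M (i, j) u\<bar> \<le> 4 * diag_weight M * \<beta>"
      by (rule abs_nbrs_le) (use ij v u in auto)
    then show "\<bar>\<epsilon>\<^sup>2 * (upper_nbrs M (i, j) v + lower_nbrs M (i, j) u)\<bar> \<le> \<epsilon>\<^sup>2 * (4 * diag_weight M * \<beta>)"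
      by (simp add: abs_mult mult_left_mono)
  qed
  also have "\<dots> = (1 / \<tau> - \<kappa> + 2 * \<epsilon>\<^sup>2 * diag_weight M) * \<beta>" by (simp add: algebra_simps)
  finally show ?thesis .
qed

lemma local_rhs_cong:
  assumes "i < M" "j < M"
    and "\<And>k l. k < M \<Longrightarrow> l < M \<Longrightarrow> i + j < k + l \<Longrightarrow> v (k, l) = w (k, l)"
  shows "local_rhs M \<epsilon> \<kappa> \<tau> u (i, j) v = local_rhs M \<epsilon> \<kappa> \<tau> u (i, j) w"
  using assms by (auto simp: local_rhs_def upper_nbrs_def intro!: arg_cong2[of _ _ _ _ "(+)"] sum.cong)

lemma linear_minus_strict_mono_on:
  fixes f f' :: "real \<Rightarrow> real"
  assumes deriv: "\<And>x. x \<in> {a..b} \<Longrightarrow> (f has_real_derivative f' x) (at x within {a..b})"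
    and c: "\<And>x. x \<in> {a..b} \<Longrightarrow> f' x < c"
  shows "strict_mono_on {a..b} (\<lambda>x. c * x - f x)"
proof (rule strict_mono_onI)
  fix x y assume x: "x \<in> {a..b}" and y: "y \<in> {a..b}" and "x < y"
  have "continuous_on {a..b} f"
    using deriv by (meson DERIV_continuous continuous_on_eq_continuous_within)
  then have cont: "continuous_on {x..y} (\<lambda>x. c * x - f x)"
    using x y by (intro continuous_intros) (auto elim: continuous_on_subset)
  show "c * x - f x < c * y - f y"
  proof (rule DERIV_pos_imp_increasing_open[OF \<open>x < y\<close> _ cont])
    fix z assume z: "x < z" "z < y"
    then have "(f has_real_derivative f' z) (at z)"
      using deriv[of z] x y by (simp add: at_within_Icc_at)
    then have "((\<lambda>x. c * x - f x) has_real_derivative c - f' z) (at z)"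
      by (auto intro!: derivative_eq_intros)
    then show "\<exists>d. ((\<lambda>x. c * x - f x) has_real_derivative d) (at z) \<and> 0 < d"
      using c[of z] z x y by auto
  qed
qed

text \<open>
  One step of the scheme as a triangular system. The rank \<open>2 M - (i + j)\<close> makes the sum of the
  indices decrease along the substitution, and the intermediate value theorem solves the
  scalar equations, whose right-hand sides stay between \<open>g (-\<beta>)\<close> and \<open>g \<beta>\<close>.
\<close>

lemma ess1_adjoint_step_ex1:
  fixes f f' :: "real \<Rightarrow> real"
  assumes beta: "\<beta> > 0"
    and deriv: "\<And>x. x \<in> {-\<beta>..\<beta>} \<Longrightarrow> (f has_real_derivative f' x) (at x within {-\<beta>..\<beta>})"
    and ends: "f \<beta> = 0" "f (-\<beta>) = 0"
    and coeff: "1 / \<tau> - \<kappa> - 2 * \<epsilon>\<^sup>2 * diag_weight M \<ge> 0"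
    and slope: "\<And>x. x \<in> {-\<beta>..\<beta>} \<Longrightarrow> f' x < 1 / \<tau> - \<kappa> + 2 * \<epsilon>\<^sup>2 * diag_weight M"
    and u: "u \<in> carrier_mat M M" and u_bd: "\<And>i j. i < M \<Longrightarrow> j < M \<Longrightarrow> \<bar>u $$ (i, j)\<bar> \<le> \<beta>"
  shows "\<exists>!v. ess1_adjoint_sol M \<beta> \<epsilon> \<kappa> \<tau> f u v"
proof -
  let ?S = "{..<M} \<times> {..<M}" and ?I = "{-\<beta>..\<beta>}"
  let ?c = "1 / \<tau> - \<kappa> + 2 * \<epsilon>\<^sup>2 * diag_weight M"
  let ?g = "local_fun M \<epsilon> \<kappa> \<tau> f" and ?F = "local_rhs M \<epsilon> \<kappa> \<tau> (($$) u)"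
  define rank where "rank = (\<lambda>(i, j). 2 * M - (i + j) :: nat)"
  have rank_less: "rank (k, l) < rank (i, j) \<longleftrightarrow> i + j < k + l"
    if "i < M" "j < M" "k < M" "l < M" for i j k l
    using that by (auto simp: rank_def)
  have sol_iff: "ess1_adjoint_sol M \<beta> \<epsilon> \<kappa> \<tau> f u v \<longleftrightarrow> v \<in> carrier_mat M M \<and>
      (\<forall>p\<in>?S. v $$ p \<in> ?I \<and> ?g (v $$ p) = ?F p (($$) v))" for v
    unfolding ess1_adjoint_sol_def using ess1_adjoint_eq_iff_local[OF u, of v \<epsilon> \<kappa> \<tau> f]
    by (auto simp del: atLeastAtMost_iff)
  have g_eq: "?g = (\<lambda>x. ?c * x - f x)" by (simp add: local_fun_def fun_eq_iff)
  have "strict_mono_on ?I ?g"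
    unfolding g_eq by (rule linear_minus_strict_mono_on[OF deriv slope])
  then have inj: "inj_on ?g ?I" by (rule strict_mono_on_imp_inj_on)
  have g_cont: "continuous_on ?I ?g"
    unfolding g_eq using deriv
    by (intro continuous_intros) (meson DERIV_continuous continuous_on_eq_continuous_within)
  have dep: "?F p v = ?F p w"
    if p: "p \<in> ?S" and eq: "\<And>q. q \<in> ?S \<Longrightarrow> rank q < rank p \<Longrightarrow> v q = w q" for p v w
  proof (cases p)
    case (Pair i j)
    then show ?thesis using p eq by (auto intro!: local_rhs_cong simp: rank_less)
  qed
  have solvable: "\<exists>x\<in>?I. ?g x = ?F p v"
    if p: "p \<in> ?S" and v: "\<And>q. q \<in> ?S \<Longrightarrow> rank q < rank p \<Longrightarrow> v q \<in> ?I" for p v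
  proof -
    obtain i j where ij: "p = (i, j)" "i < M" "j < M" using p by auto
    have "\<bar>v (k, l)\<bar> \<le> \<beta>" if "k < M" "l < M" "i + j < k + l" for k l
      using v[of "(k, l)"] that ij by (auto simp: rank_less abs_le_iff)
    then have "\<bar>?F p v\<bar> \<le> ?c * \<beta>"
      unfolding ij(1) using ij u_bd coeff by (intro abs_local_rhs_le) auto
    then have "?g (-\<beta>) \<le> ?F p v" "?F p v \<le> ?g \<beta>"
      unfolding g_eq by (auto simp: ends abs_le_iff)
    then obtain x where "-\<beta> \<le> x" "x \<le> \<beta>" "?g x = ?F p v"
      using IVT'[of ?g "-\<beta>" "?F p v" \<beta>] g_cont beta by auto
    then show ?thesis by auto
  qed
  obtain w where w: "\<forall>p\<in>?S. w p \<in> ?I \<and> ?g (w p) = ?F p w"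
    using triangular_system_solvable[of ?S rank ?F ?I ?g, OF dep solvable] by blast
  have "ess1_adjoint_sol M \<beta> \<epsilon> \<kappa> \<tau> f u (mat M M w)"
    unfolding sol_iff
  proof (intro conjI ballI)
    fix p assume p: "p \<in> ?S"
    have "?F p (($$) (mat M M w)) = ?F p w"
      by (rule dep[OF p]) auto
    moreover have "mat M M w $$ p = w p" using p by auto
    ultimately show "mat M M w $$ p \<in> ?I" "?g (mat M M w $$ p) = ?F p (($$) (mat M M w))"
      using w p by metis+
  qed simp
  moreover have "v = v'"
    if v: "ess1_adjoint_sol M \<beta> \<epsilon> \<kappa> \<tau> f u v" and v': "ess1_adjoint_sol M \<beta> \<epsilon> \<kappa> \<tau> f u v'" for v v'
  proof -
    have "v $$ p = v' $$ p" if "p \<in> ?S" for p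
      using triangular_system_unique[of ?S rank ?F ?g ?I "($$) v" "($$) v'", OF dep inj _ _ that]
        v v' unfolding sol_iff by blast
    then show ?thesis using v v' unfolding sol_iff by (intro eq_matI) auto
  qed
  ultimately show ?thesis by blast
qed

section \<open>Norms and the step size condition\<close>

lemma grid_norm_le_iff:
  assumes "M > 0" "v \<in> carrier_mat M M"
  shows "grid_norm v \<le> \<beta> \<longleftrightarrow> (\<forall>i<M. \<forall>j<M. \<bar>v $$ (i, j)\<bar> \<le> \<beta>)"
proof -
  let ?E = "{\<bar>v $$ (i, j)\<bar> | i j. i < M \<and> j < M}"
  have "?E = (\<lambda>(i, j). \<bar>v $$ (i, j)\<bar>) ` ({..<M} \<times> {..<M})" by auto
  then have "finite ?E" by simp
  moreover have "?E \<noteq> {}" using assms(1) by auto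
  ultimately have "Max ?E \<le> \<beta> \<longleftrightarrow> (\<forall>x\<in>?E. x \<le> \<beta>)" by (rule Max_le_iff)
  moreover have "grid_norm v = Max ?E" using assms(2) by (auto simp: grid_norm_def)
  ultimately show ?thesis by auto
qed

lemma abs_le_sup_norm_on:
  assumes "continuous_on S g" "compact S" "x \<in> S"
  shows "\<bar>g x\<bar> \<le> sup_norm_on S g"
proof -
  have "bounded ((\<lambda>x. \<bar>g x\<bar>) ` S)"
    using assms by (intro compact_imp_bounded compact_continuous_image continuous_intros)
  then show ?thesis
    unfolding sup_norm_on_def using assms by (intro cSUP_upper bounded_imp_bdd_above)
qed

text \<open>For \<open>s = 0\<close> both sides hold, the left one because \<open>1 / 0 = \<infinity>\<close> in the extended reals.\<close>

lemma le_ereal_inverse_iff: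
  assumes "\<tau> > 0" "s \<ge> 0"
  shows "ereal \<tau> \<le> 1 / ereal s \<longleftrightarrow> s \<le> 1 / \<tau>" and "ereal \<tau> < 1 / ereal s \<longleftrightarrow> s < 1 / \<tau>"
  using assms by (cases "s = 0"; simp add: one_ereal_def field_simps)+

theorem theorem3p2:
  fixes M :: nat and \<beta> \<epsilon> \<kappa> \<tau> T :: real and f f' :: "real \<Rightarrow> real" and u0 :: "real mat"
  assumes "M > 0" and "\<epsilon> > 0" and "T > 0" and "\<beta> > 0" and "\<kappa> \<ge> 0"
    and f_deriv: "\<And>x. x \<in> {-\<beta>..\<beta>} \<Longrightarrow> (f has_real_derivative f' x) (at x within {-\<beta>..\<beta>})"
    and f'_cont: "continuous_on {-\<beta>..\<beta>} f'"
    and f_odd: "\<And>x. x \<in> {-\<beta>..\<beta>} \<Longrightarrow> f (- x) = - f x"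
    and f_zero: "f \<beta> = 0"
    and u0: "u0 \<in> carrier_mat M M" and u0_bound: "grid_norm u0 \<le> \<beta>"
    and tau_pos: "\<tau> > 0"
    and tau_le: "ereal \<tau> \<le>
      min (ereal ((mesh M)\<^sup>2 / (\<kappa> * (mesh M)\<^sup>2 + 2 * \<epsilon>\<^sup>2))) (stab_bound \<beta> \<kappa> f')"
    and one_point_grid: "M = 1 \<Longrightarrow> ereal \<tau> < stab_bound \<beta> \<kappa> f'"
  shows "(\<forall>n < nat \<lfloor>T / \<tau>\<rfloor>.
            \<exists>!v. ess1_adjoint_sol M \<beta> \<epsilon> \<kappa> \<tau> f (ess1_adjoint M \<beta> \<epsilon> \<kappa> \<tau> f u0 n) v) \<and>
         (\<forall>n \<le> nat \<lfloor>T / \<tau>\<rfloor>. grid_norm (ess1_adjoint M \<beta> \<epsilon> \<kappa> \<tau> f u0 n) \<le> \<beta>)"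
proof -
  let ?I = "{-\<beta>..\<beta>}" and ?L = "sup_norm_on {-\<beta>..\<beta>} f'"
  note M = \<open>M > 0\<close>
  have f'_le: "\<bar>f' x\<bar> \<le> ?L" if "x \<in> ?I" for x
    using abs_le_sup_norm_on[OF f'_cont compact_Icc that] .
  have "\<bar>f' \<beta>\<bar> \<le> ?L" using f'_le \<open>\<beta> > 0\<close> by simp
  then have s_nonneg: "\<kappa> + ?L \<ge> 0" using \<open>\<kappa> \<ge> 0\<close> by linarith
  have s_le: "\<kappa> + ?L \<le> 1 / \<tau>"
    using tau_le le_ereal_inverse_iff(1)[OF tau_pos s_nonneg] by (simp add: stab_bound_def)
  have slope: "f' x < 1 / \<tau> - \<kappa> + 2 * \<epsilon>\<^sup>2 * diag_weight M" if "x \<in> ?I" for x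
  proof (cases "M = 1")
    case True
    then have "\<kappa> + ?L < 1 / \<tau>"
      using one_point_grid le_ereal_inverse_iff(2)[OF tau_pos s_nonneg]
      by (simp add: stab_bound_def)
    then show ?thesis using f'_le[OF that] True by (simp add: diag_weight_def)
  next
    case False
    then have "\<epsilon>\<^sup>2 * diag_weight M > 0"
      using \<open>\<epsilon> > 0\<close> mesh_pos[OF M] by (simp add: diag_weight_def)
    then show ?thesis using f'_le[OF that] s_le by linarith
  qed
  have coeff: "1 / \<tau> - \<kappa> - 2 * \<epsilon>\<^sup>2 * diag_weight M \<ge> 0"
  proof -
    let ?H = "(mesh M)\<^sup>2"
    have H: "?H > 0" using mesh_pos[OF M] by simp
    have pos: "\<kappa> * ?H + 2 * \<epsilon>\<^sup>2 > 0"
      using H \<open>\<kappa> \<ge> 0\<close> \<open>\<epsilon> > 0\<close> by (intro add_nonneg_pos) auto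
    have "\<tau> \<le> ?H / (\<kappa> * ?H + 2 * \<epsilon>\<^sup>2)" using tau_le by simp
    then have "\<kappa> + 2 * \<epsilon>\<^sup>2 * (1 / ?H) \<le> 1 / \<tau>"
      using H pos tau_pos by (simp add: field_simps)
    moreover have "2 * \<epsilon>\<^sup>2 * diag_weight M \<le> 2 * \<epsilon>\<^sup>2 * (1 / ?H)"
      by (intro mult_left_mono diag_weight_le) simp
    ultimately show ?thesis by linarith
  qed
  have f_zero': "f (-\<beta>) = 0" using f_odd[of \<beta>] f_zero \<open>\<beta> > 0\<close> by simp
  let ?u = "ess1_adjoint M \<beta> \<epsilon> \<kappa> \<tau> f u0"
  have step: "\<exists>!v. ess1_adjoint_sol M \<beta> \<epsilon> \<kappa> \<tau> f u v"
    if "u \<in> carrier_mat M M" "grid_norm u \<le> \<beta>" for u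
    using that M grid_norm_le_iff[of M u \<beta>]
    by (intro ess1_adjoint_step_ex1[OF \<open>\<beta> > 0\<close> f_deriv f_zero f_zero' coeff slope]) auto
  have inv: "?u n \<in> carrier_mat M M \<and> grid_norm (?u n) \<le> \<beta>" for n
  proof (induction n)
    case 0
    then show ?case using u0 u0_bound by simp
  next
    case (Suc n)
    have "ess1_adjoint_sol M \<beta> \<epsilon> \<kappa> \<tau> f (?u n) (?u (Suc n))"
      using theI'[OF step] Suc by simp
    then have car: "?u (Suc n) \<in> carrier_mat M M"
      and bd: "\<forall>i<M. \<forall>j<M. ?u (Suc n) $$ (i, j) \<in> {-\<beta>..\<beta>}"
      unfolding ess1_adjoint_sol_def by blast+
    have "\<forall>i<M. \<forall>j<M. \<bar>?u (Suc n) $$ (i, j)\<bar> \<le> \<beta>"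
      using bd unfolding atLeastAtMost_iff by (metis abs_le_iff minus_le_iff)
    then show ?case using car grid_norm_le_iff[OF M car] by blast
  qed
  then show ?thesis using step by blast
qed

end
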